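(* Let $\mathcal{E}: M_d(\mathbb{C})\to M_d(\mathbb{C})$ be a quantum channel with Kraus operators $A_1,A_2,\dots,A_\kappa$. If $|\psi\rangle\in\mathbb{C}^d$ is a common eigenstate of the operators $A_i$ (that is, a unit vector such that for every $i=1,\dots,\kappa$ there is $\lambda_i\in\mathbb{C}$ with $A_i|\psi\rangle=\lambda_i|\psi\rangle$), then $|\psi\rangle$ is a fixed point of $\mathcal{E}$, i.e. $\mathcal{E}(|\psi\rangle\langle\psi|)=|\psi\rangle\langle\psi|$.
   Context: A quantum channel on $\mathcal{H}\cong\mathbb{C}^d$ is a completely positive trace-preserving linear map $\mathcal{E}(\rho)=\sum_{i=1}^{\kappa}A_i\rho A_i^\dagger$ with Kraus operators $A_i\in M_d(\mathbb{C})$ satisfying $\sum_{i=1}^{\kappa}A_i^\dagger A_i=\mathbb{I}$ and $\kappa\le d^2$. A pure state $|\psi\rangle$ is identified with the density operator $|\psi\rangle\langle\psi|$, so $\mathcal{E}(|\psi\rangle)$ means $\sum_{i=1}^{\kappa}A_i|\psi\rangle\langle\psi|A_i^\dagger$. A fixed point of $\mathcal{E}$ is a quantum state $\rho$ with $\mathcal{E}(\rho)=\rho$. *)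

theory Defs
  imports "HOL-Analysis.Analysis"
begin

text \<open>
  The algebra of complex \<open>d \<times> d\<close> matrices is \<^typ>\<open>complex^'d^'d\<close>, with \<open>d = CARD('d)\<close>.
  The norm of \<^typ>\<open>complex^'d\<close> is the Hermitian norm, so unit vectors satisfy \<open>norm \<psi> = 1\<close>.
\<close>

definition mat_adjoint :: "complex^'d^'d \<Rightarrow> complex^'d^'d" where
  "mat_adjoint A = (\<chi> i j. cnj (A $ j $ i))"

definition mat_scale :: "complex \<Rightarrow> complex^'d^'d \<Rightarrow> complex^'d^'d" where
  "mat_scale c X = (\<chi> i j. c * X $ i $ j)"

definition cinner :: "complex^'d \<Rightarrow> complex^'d \<Rightarrow> complex" where
  "cinner u v = (\<Sum>i\<in>UNIV. cnj (u $ i) * v $ i)"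

definition ket_bra :: "complex^'d \<Rightarrow> complex^'d^'d" where
  "ket_bra \<psi> = (\<chi> i j. \<psi> $ i * cnj (\<psi> $ j))"

definition density_operator :: "complex^'d^'d \<Rightarrow> bool" where
  "density_operator \<rho> \<longleftrightarrow>
     (\<forall>v. cinner v (\<rho> *v v) \<in> \<real>\<^sub>\<ge>\<^sub>0) \<and> trace \<rho> = 1"

text \<open>
  An element of \<open>M\<^sub>k(M\<^sub>d(\<complex>))\<close> is a family of blocks \<open>X a b\<close> with \<open>a, b < k\<close>, acting on
  \<open>(\<complex>\<^sup>d)\<^sup>k\<close>. Only the blocks and the components \<open>v a\<close> with indices below \<open>k\<close> matter.
\<close>

definition block_positive :: "nat \<Rightarrow> (nat \<Rightarrow> nat \<Rightarrow> complex^'d^'d) \<Rightarrow> bool" where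
  "block_positive k X \<longleftrightarrow>
     (\<forall>v. (\<Sum>a<k. \<Sum>b<k. cinner (v a) (X a b *v v b)) \<in> \<real>\<^sub>\<ge>\<^sub>0)"

text \<open>
  Under \<open>M\<^sub>k(\<complex>) \<otimes> M\<^sub>d(\<complex>) = M\<^sub>k(M\<^sub>d(\<complex>))\<close>, the map \<open>id \<otimes> E\<close> is \<open>E\<close> applied to every block.
\<close>

definition completely_positive :: "(complex^'d^'d \<Rightarrow> complex^'d^'d) \<Rightarrow> bool" where
  "completely_positive E \<longleftrightarrow>
     (\<forall>k X. block_positive k X \<longrightarrow> block_positive k (\<lambda>a b. E (X a b)))"

definition trace_preserving :: "(complex^'d^'d \<Rightarrow> complex^'d^'d) \<Rightarrow> bool" where
  "trace_preserving E \<longleftrightarrow> (\<forall>X. trace (E X) = trace X)"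

definition quantum_channel :: "(complex^'d^'d \<Rightarrow> complex^'d^'d) \<Rightarrow> bool" where
  "quantum_channel E \<longleftrightarrow>
     Vector_Spaces.linear mat_scale mat_scale E \<and> completely_positive E \<and> trace_preserving E"

definition kraus_operators ::
  "(complex^'d^'d \<Rightarrow> complex^'d^'d) \<Rightarrow> nat \<Rightarrow> (nat \<Rightarrow> complex^'d^'d) \<Rightarrow> bool" where
  "kraus_operators E \<kappa> A \<longleftrightarrow>
     \<kappa> \<le> CARD('d)\<^sup>2 \<and>
     (\<Sum>i=1..\<kappa>. mat_adjoint (A i) ** A i) = mat 1 \<and>
     (\<forall>\<rho>. E \<rho> = (\<Sum>i=1..\<kappa>. A i ** \<rho> ** mat_adjoint (A i)))"

definition common_eigenstate ::
  "nat \<Rightarrow> (nat \<Rightarrow> complex^'d^'d) \<Rightarrow> complex^'d \<Rightarrow> bool" where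
  "common_eigenstate \<kappa> A \<psi> \<longleftrightarrow>
     norm \<psi> = 1 \<and> (\<forall>i\<in>{1..\<kappa>}. \<exists>c. A i *v \<psi> = c *s \<psi>)"

definition fixed_point :: "(complex^'d^'d \<Rightarrow> complex^'d^'d) \<Rightarrow> complex^'d^'d \<Rightarrow> bool" where
  "fixed_point E \<rho> \<longleftrightarrow> density_operator \<rho> \<and> E \<rho> = \<rho>"

end

theory Submission
  imports Defs
begin

text \<open>
  Conjugating a pure state by a Kraus operator gives \<open>A |\<psi>\<rangle>\<langle>\<psi>| A\<^sup>\<dagger> = |A\<psi>\<rangle>\<langle>A\<psi>|\<close>, so a common
  eigenstate with eigenvalues \<open>c\<^sub>i\<close> is sent to \<open>(\<Sum>\<^sub>i |c\<^sub>i|\<^sup>2) |\<psi>\<rangle>\<langle>\<psi>|\<close>. Trace preservation forces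
  the scalar to be 1.
\<close>

lemma sandwich_ket_bra: "A ** ket_bra \<psi> ** mat_adjoint A = ket_bra (A *v \<psi>)"
  by (simp add: vec_eq_iff ket_bra_def mat_adjoint_def matrix_matrix_mult_def
      matrix_vector_mult_def sum_product sum_distrib_left sum_distrib_right mult_ac)

lemma ket_bra_scale: "ket_bra (c *s \<psi>) = mat_scale (c * cnj c) (ket_bra \<psi>)"
  by (simp add: vec_eq_iff ket_bra_def mat_scale_def)

lemma trace_mat_scale: "trace (mat_scale c X) = c * trace X"
  by (simp add: trace_def mat_scale_def sum_distrib_left)

lemma sum_mat_scale: "(\<Sum>i\<in>I. mat_scale (f i) X) = mat_scale (\<Sum>i\<in>I. f i) X"
  by (simp add: vec_eq_iff mat_scale_def sum_component sum_distrib_right)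

lemma trace_ket_bra: "trace (ket_bra \<psi>) = of_real ((norm \<psi>)\<^sup>2)"
  by (simp add: trace_def ket_bra_def norm_vec_def L2_set_def sum_nonneg
      flip: complex_norm_square)

text \<open>The quadratic form factors as a number times its conjugate, because
  \<open>ket_bra \<psi>\<close> has rank at most one. This supplies the positivity half of
  \<open>density_operator\<close>.\<close>

lemma cinner_ket_bra: "cinner v (ket_bra \<psi> *v v) = of_real ((cmod (cinner v \<psi>))\<^sup>2)"
  unfolding complex_norm_square
  \<comment> \<open>Both sides expand to the same double sum, with the two summations in opposite
    orders.\<close>
  by (simp add: cinner_def ket_bra_def matrix_vector_mult_def sum_distrib_left sum_distrib_right
      mult_ac) (rule sum.swap)

lemma density_operator_ket_bra:
  assumes "norm \<psi> = 1"
  shows "density_operator (ket_bra \<psi>)"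
  using assms by (simp add: density_operator_def cinner_ket_bra trace_ket_bra)

theorem mainTheorem3:
  fixes E :: "complex^'d^'d \<Rightarrow> complex^'d^'d"
    and A :: "nat \<Rightarrow> complex^'d^'d"
    and \<kappa> :: nat
    and \<psi> :: "complex^'d"
  assumes "quantum_channel E"
    and "kraus_operators E \<kappa> A"
    and "common_eigenstate \<kappa> A \<psi>"
  shows "fixed_point E (ket_bra \<psi>)"
proof -
  have unit: "norm \<psi> = 1"
    using assms(3) by (simp add: common_eigenstate_def)
  \<comment> \<open>One choice function for the eigenvalues, so that they can be summed over the
    index.\<close>
  obtain c where c: "\<And>i. i \<in> {1..\<kappa>} \<Longrightarrow> A i *v \<psi> = c i *s \<psi>"
    using assms(3) unfolding common_eigenstate_def by metis
  define s where "s = (\<Sum>i=1..\<kappa>. c i * cnj (c i))"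
  have "E (ket_bra \<psi>) = (\<Sum>i=1..\<kappa>. ket_bra (A i *v \<psi>))"
    using assms(2) by (simp add: kraus_operators_def sandwich_ket_bra)
  also have "\<dots> = (\<Sum>i=1..\<kappa>. mat_scale (c i * cnj (c i)) (ket_bra \<psi>))"
    by (intro sum.cong refl) (simp only: c ket_bra_scale)
  finally have E: "E (ket_bra \<psi>) = mat_scale s (ket_bra \<psi>)"
    by (simp add: s_def sum_mat_scale)
  have "trace (E (ket_bra \<psi>)) = trace (ket_bra \<psi>)"
    using assms(1) by (simp add: quantum_channel_def trace_preserving_def)
  \<comment> \<open>By fact \<open>E\<close> the left trace is \<open>s\<close> times that of
    \<open>ket_bra \<psi>\<close>, which is 1 for a unit vector and so cancels.\<close>
  then have "s = 1"
    by (simp add: E trace_mat_scale trace_ket_bra unit)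
  then have "E (ket_bra \<psi>) = ket_bra \<psi>"
    by (simp add: E mat_scale_def)
  then show ?thesis
    using density_operator_ket_bra[OF unit] by (simp add: fixed_point_def)
qed

end
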